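(* Let $S$ be a semigroup that satisfies Property (C$_3$) and let $k\ge 2$. If for each $n\ge 2$, $S$ satisfies the identity $$x^k y_1^k y_2^k\cdots y_n^k x^k\approx x^k y_n^k y_{n-1}^k\cdots y_1^k x^k,$$ where $x,y_1,\dots,y_n$ are distinct variables, then $S$ is non-finitely based.
   Context: Let $\mathfrak A$ be a countably infinite alphabet of variables; elements of the free semigroup $\mathfrak A^+$ are called words. An identity is a formal equality $\mathbf u\approx\mathbf v$ of words; a semigroup $S$ satisfies it if $\mathbf u$ and $\mathbf v$ take equal values under every assignment of elements of $S$ to the variables. $S$ is finitely based if there is a finite subset of its identities from which all its identities can be deduced; otherwise $S$ is non-finitely based. Two words have the same type if one can be obtained from the other by changing the individual exponents of variables, i.e. they can be written as $c_1^{u_1}\cdots c_r^{u_r}$ and $c_1^{v_1}\cdots c_r^{v_r}$ with variables $c_i\neq c_{i+1}$ and all $u_i,v_i\ge 1$. An island formed by a variable $x$ in a word $\mathbf u$ is a maximal (contiguous) subword of $\mathbf u$ that is a power of $x$. The height of a word over a two-letter alphabet is its number of islands. For $\ell\ge 2$, a semigroup $S$ satisfies Property (C$_\ell$) if for every word $\mathbf u\in\{x,y\}^+$ ($x,y$ distinct variables) of height at most $\ell$, whenever $S$ satisfies an identity $\mathbf u\approx\mathbf v$, the word $\mathbf v$ has the same type as $\mathbf u$. *)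

theory Defs
  imports Main
begin

type_synonym var = nat

text \<open>Elements of the free semigroup are the nonempty lists of variables.\<close>

type_synonym word = "var list"

text \<open>The value at the empty list is irrelevant: it is not a word.\<close>

fun eval :: "('a \<Rightarrow> 'a \<Rightarrow> 'a) \<Rightarrow> (var \<Rightarrow> 'a) \<Rightarrow> word \<Rightarrow> 'a" where
  "eval f \<phi> [] = undefined"
| "eval f \<phi> [x] = \<phi> x"
| "eval f \<phi> (x # y # w) = f (\<phi> x) (eval f \<phi> (y # w))"

definition satisfies :: "('a \<Rightarrow> 'a \<Rightarrow> 'a) \<Rightarrow> word \<Rightarrow> word \<Rightarrow> bool" where
  "satisfies f u v \<longleftrightarrow> u \<noteq> [] \<and> v \<noteq> [] \<and> (\<forall>\<phi>. eval f \<phi> u = eval f \<phi> v)"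

definition subst :: "(var \<Rightarrow> word) \<Rightarrow> word \<Rightarrow> word" where
  "subst \<theta> w = concat (map \<theta> w)"

text \<open>Equational deduction for semigroup identities; associativity is built into the
  representation of words. Only nonempty words may be substituted for variables.\<close>

inductive deducible :: "(word \<times> word) set \<Rightarrow> word \<Rightarrow> word \<Rightarrow> bool"
  for \<Sigma> :: "(word \<times> word) set" where
  axm: "(u, v) \<in> \<Sigma> \<Longrightarrow> deducible \<Sigma> u v"
| refl: "u \<noteq> [] \<Longrightarrow> deducible \<Sigma> u u"
| sym: "deducible \<Sigma> u v \<Longrightarrow> deducible \<Sigma> v u"
| trans: "deducible \<Sigma> u v \<Longrightarrow> deducible \<Sigma> v w \<Longrightarrow> deducible \<Sigma> u w"
| mult: "deducible \<Sigma> u v \<Longrightarrow> deducible \<Sigma> u' v' \<Longrightarrow> deducible \<Sigma> (u @ u') (v @ v')"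
| subst: "deducible \<Sigma> u v \<Longrightarrow> (\<And>x. \<theta> x \<noteq> []) \<Longrightarrow> deducible \<Sigma> (subst \<theta> u) (subst \<theta> v)"

definition finitely_based :: "('a \<Rightarrow> 'a \<Rightarrow> 'a) \<Rightarrow> bool" where
  "finitely_based f \<longleftrightarrow>
    (\<exists>\<Sigma>. finite \<Sigma> \<and> (\<forall>(u, v) \<in> \<Sigma>. satisfies f u v) \<and>
      (\<forall>u v. satisfies f u v \<longrightarrow> deducible \<Sigma> u v))"

definition same_type :: "word \<Rightarrow> word \<Rightarrow> bool" where
  "same_type u v \<longleftrightarrow>
    (\<exists>cs us vs. distinct_adj cs \<and> length us = length cs \<and> length vs = length cs \<and>
      (\<forall>m \<in> set us. 1 \<le> m) \<and> (\<forall>m \<in> set vs. 1 \<le> m) \<and>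
      u = concat (map2 replicate us cs) \<and> v = concat (map2 replicate vs cs))"

text \<open>The factor of \<open>u\<close> occupying the positions \<open>i, \<dots>, j - 1\<close> is a power of \<open>x\<close>.\<close>

definition power_at :: "word \<Rightarrow> var \<Rightarrow> nat \<Rightarrow> nat \<Rightarrow> bool" where
  "power_at u x i j \<longleftrightarrow> i < j \<and> j \<le> length u \<and> (\<forall>p \<in> {i..<j}. u ! p = x)"

text \<open>Islands are counted as occurrences of factors, so they are identified with their
  position intervals: \<open>x y x\<close> has three islands.\<close>

definition islands :: "word \<Rightarrow> (nat \<times> nat) set" where
  "islands u = {(i, j). \<exists>x. power_at u x i j \<and>
    (\<forall>i' j'. i' \<le> i \<and> j \<le> j' \<and> power_at u x i' j' \<longrightarrow> i' = i \<and> j' = j)}"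

definition height :: "word \<Rightarrow> nat" where
  "height u = card (islands u)"

definition property_C :: "nat \<Rightarrow> ('a \<Rightarrow> 'a \<Rightarrow> 'a) \<Rightarrow> bool" where
  "property_C l f \<longleftrightarrow>
    (\<forall>x y u v. x \<noteq> y \<and> u \<noteq> [] \<and> set u \<subseteq> {x, y} \<and> height u \<le> l \<and> satisfies f u v
      \<longrightarrow> same_type u v)"

end

theory Submission
  imports Defs
begin

text \<open>Let \<open>\<U>\<close> be the set of words of the type \<open>x y\<^sub>1 \<dots> y\<^sub>n x\<close>. Property (C\<open>\<^sub>3\<close>), applied to the
  two-letter images of a word in \<open>\<U>\<close>, shows that a word equal to it in the semigroup has
  the type \<open>x y\<^sub>1 \<dots> y\<^sub>n x\<close> or the reversed type: each single letter \<open>y\<^sub>i\<close> and each pair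
  \<open>y\<^sub>i, y\<^sub>i\<^sub>+\<^sub>1\<close> must stay together. The two types have no two-letter factor \<open>a b\<close> with
  \<open>a \<noteq> b\<close> in common. If a deduction step turned \<open>p \<theta>(u) q\<close> into the reverse type
  \<open>p \<theta>(v) q\<close>, then \<open>p\<close>, \<open>q\<close> and all \<open>\<theta>(t)\<close>, being factors of both, would be powers of
  single letters, so \<open>u\<close> would need at least \<open>n - 1\<close> variables to cover the \<open>n + 1\<close> letters.
  Hence identities in few variables preserve \<open>\<U>\<close> and cannot yield the given one.\<close>

subsection \<open>Words up to type\<close>

text \<open>The type of a word is represented by its image under \<^const>\<open>remdups_adj\<close>.\<close>

lemma remdups_adj_concat_replicate:
  "k \<ge> 1 \<Longrightarrow> remdups_adj (concat (map (replicate k) w)) = remdups_adj w"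
proof (induction w)
  case (Cons c w)
  obtain l where l: "k = Suc l" using Cons.prems by (cases k) auto
  have *: "remdups_adj (c # replicate j c @ v) = remdups_adj (c # v)" for j v
    by (induction j) auto
  have "remdups_adj (concat (map (replicate k) (c # w)))
      = remdups_adj (c # concat (map (replicate k) w))"
    by (simp add: l *)
  also have "\<dots> = remdups_adj (c # w)"
    using Cons by (simp add: remdups_adj_Cons)
  finally show ?case .
qed simp

lemma remdups_adj_concat_map2_replicate:
  assumes "length us = length cs" "\<forall>m \<in> set us. 1 \<le> m"
  shows "remdups_adj (concat (map2 replicate us cs)) = remdups_adj cs"
  using assms
proof (induction us cs rule: list_induct2)
  case (Cons m us c cs)
  obtain l where l: "m = Suc l" using Cons.prems by (cases m) auto
  have *: "remdups_adj (c # replicate j c @ w) = remdups_adj (c # w)" for j w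
    by (induction j) auto
  have "remdups_adj (concat (map2 replicate (m # us) (c # cs)))
      = remdups_adj (c # concat (map2 replicate us cs))"
    by (simp add: l *)
  also have "\<dots> = remdups_adj (c # cs)"
    using Cons by (simp add: remdups_adj_Cons)
  finally show ?case .
qed simp

lemma same_type_imp_remdups_adj_eq:
  "same_type u v \<Longrightarrow> remdups_adj u = remdups_adj v"
  unfolding same_type_def by (auto simp: remdups_adj_concat_map2_replicate)

text \<open>Lets two-letter images be computed from the type of a word alone, so that
  \<open>few_variables_step\<close> can apply \<open>eq_or_rev_of_projections\<close> to the reduced
  word \<open>remdups_adj ?V\<close>.\<close>

lemma remdups_adj_map_remdups_adj:
  "remdups_adj (map g (remdups_adj w)) = remdups_adj (map g w)"
proof (induction w rule: remdups_adj.induct)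
  case (3 a b w)
  show ?case
  proof (cases "a = b")
    case False
    have "remdups_adj (map g (remdups_adj (a # b # w))) = remdups_adj (g a # map g (remdups_adj (b # w)))"
      using False by simp
    also have "\<dots> = remdups_adj (g a # map g (b # w))"
      unfolding remdups_adj_Cons[of "g a"] 3(2)[OF False] ..
    finally show ?thesis by simp
  qed (use 3 in simp)
qed simp_all

lemma card_island_starts:
  "card {i. i < length u \<and> (i = 0 \<or> u ! (i - 1) \<noteq> u ! i)} = length (remdups_adj u)"
proof (induction u rule: remdups_adj.induct)
  case (3 a b w)
  let ?S = "\<lambda>u. {i. i < length u \<and> (i = 0 \<or> u ! (i - 1) \<noteq> u ! i)}"
  \<comment> \<open>Prepending \<open>a\<close> shifts all starts by one and adds a start at 0; the
    old start 0 survives exactly when \<open>a\<close> differs from \<open>b\<close>.\<close>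
  have eq: "?S (a # b # w) = insert 0 (Suc ` (?S (b # w) - (if a = b then {0} else {})))"
  proof (rule set_eqI)
    fix i show "i \<in> ?S (a # b # w) \<longleftrightarrow> i \<in> insert 0 (Suc ` (?S (b # w) - (if a = b then {0} else {})))"
    proof (cases i)
      case (Suc j) then show ?thesis by (cases j) auto
    qed simp
  qed
  have fin: "finite (?S (b # w))" by simp
  have 0: "0 \<in> ?S (b # w)" by simp
  have "card (?S (a # b # w)) = Suc (card (?S (b # w) - (if a = b then {0} else {})))"
    unfolding eq using fin by (subst card_insert_disjoint) (auto simp: card_image)
  also have "\<dots> = (if a = b then card (?S (b # w)) else Suc (card (?S (b # w))))"
    using card.remove[OF fin 0] by auto
  finally show ?case using 3 by auto
next
  case (2 a)
  have "{i. i < length [a] \<and> (i = 0 \<or> [a] ! (i - 1) \<noteq> [a] ! i)} = {0}" by auto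
  then show ?case by simp
qed simp

text \<open>An island is determined by its left end, at which a new letter starts. An upper bound
  suffices, since \<open>property_C\<close> asks for height at most \<open>l\<close>.\<close>

lemma height_le_length_remdups_adj: "height u \<le> length (remdups_adj u)"
proof -
  let ?S = "{i. i < length u \<and> (i = 0 \<or> u ! (i - 1) \<noteq> u ! i)}"
  have "inj_on fst (islands u)"
  proof (rule inj_onI)
    fix a b assume a: "a \<in> islands u" and b: "b \<in> islands u" and eq: "fst a = fst b"
    obtain i j j' where ij: "a = (i, j)" "b = (i, j')"
      using eq by (cases a, cases b) auto
    obtain z where z: "power_at u z i j"
      "\<And>i' j'. i' \<le> i \<Longrightarrow> j \<le> j' \<Longrightarrow> power_at u z i' j' \<Longrightarrow> i' = i \<and> j' = j"
      using a unfolding islands_def ij by auto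
    obtain z' where z': "power_at u z' i j'"
      "\<And>i' k. i' \<le> i \<Longrightarrow> j' \<le> k \<Longrightarrow> power_at u z' i' k \<Longrightarrow> i' = i \<and> k = j'"
      using b unfolding islands_def ij by auto
    \<comment> \<open>Both islands are powers of the letter at their common left end, so maximality
      of the shorter one rules out different right ends.\<close>
    have "z = u ! i" "z' = u ! i" using z(1) z'(1) unfolding power_at_def by (metis atLeastLessThan_iff order_refl)+
    then show "a = b" using z z' ij by (metis le_cases order_refl)
  qed
  moreover have "fst ` islands u \<subseteq> ?S"
  proof
    fix i assume "i \<in> fst ` islands u"
    then obtain j z where z: "power_at u z i j"
      "\<And>i' j'. i' \<le> i \<Longrightarrow> j \<le> j' \<Longrightarrow> power_at u z i' j' \<Longrightarrow> i' = i \<and> j' = j"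
      unfolding islands_def by auto
    have "u ! (i - 1) \<noteq> u ! i" if "i \<noteq> 0"
    proof
      assume eq: "u ! (i - 1) = u ! i"
      have "u ! p = z" if "p \<in> {i - 1..<j}" for p
        using z(1) eq that unfolding power_at_def by (cases "p = i - 1") auto
      then have "power_at u z (i - 1) j" using z(1) unfolding power_at_def by auto
      then show False using z(2)[of "i - 1" j] that by auto
    qed
    then show "i \<in> ?S" using z(1) unfolding power_at_def by auto
  qed
  ultimately have "card (islands u) \<le> card ?S"
    using card_inj_on_le[of fst "islands u" ?S] by simp
  then show ?thesis unfolding height_def card_island_starts .
qed

subsection \<open>Consequences of satisfied identities\<close>

lemma eval_append:
  assumes "semigroup f" "u \<noteq> []" "v \<noteq> []"
  shows "eval f \<phi> (u @ v) = f (eval f \<phi> u) (eval f \<phi> v)"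
  using assms(2)
\<comment> \<open>The rule serves for its split into empty, one-letter and longer words; in the last
  case one of its two hypotheses applies, according to whether \<open>a = b\<close>.\<close>
proof (induction u rule: remdups_adj.induct)
  case (2 a)
  then show ?case using assms(3) by (cases v) auto
next
  case (3 a b w)
  then show ?case
    using semigroup.assoc[OF assms(1)] by (cases "a = b") auto
qed simp

lemma eval_subst:
  assumes "semigroup f" "\<And>t. \<theta> t \<noteq> []" "u \<noteq> []"
  shows "eval f \<phi> (subst \<theta> u) = eval f (\<lambda>t. eval f \<phi> (\<theta> t)) u"
  using assms(3)
proof (induction u rule: induct_list012)
  case (3 a b w)
  have "subst \<theta> (b # w) \<noteq> []" using assms(2) by (simp add: subst_def)
  moreover have "subst \<theta> (a # b # w) = \<theta> a @ subst \<theta> (b # w)" by (simp add: subst_def)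
  ultimately show ?case using 3 eval_append[OF assms(1)] assms(2) by simp
qed (simp_all add: subst_def)

lemma subst_ne: "\<lbrakk>\<And>t. \<theta> t \<noteq> []; u \<noteq> []\<rbrakk> \<Longrightarrow> subst \<theta> u \<noteq> []"
  by (cases u) (auto simp: subst_def)

lemma satisfies_subst:
  assumes "semigroup f" "satisfies f u v" "\<And>t. \<theta> t \<noteq> []"
  shows "satisfies f (subst \<theta> u) (subst \<theta> v)"
  using assms unfolding satisfies_def by (simp add: eval_subst subst_ne)

lemma satisfies_context:
  assumes "semigroup f" "satisfies f u v"
  shows "satisfies f (p @ u @ q) (p @ v @ q)"
proof -
  have "satisfies f (u @ q) (v @ q)"
    using assms by (cases "q = []") (auto simp: satisfies_def eval_append)
  then show ?thesis
    using assms by (cases "p = []") (auto simp: satisfies_def eval_append)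
qed

lemma satisfies_sym: "satisfies f u v \<Longrightarrow> satisfies f v u"
  unfolding satisfies_def by auto

lemma remdups_adj_map_of_bool:
  fixes P :: "'b \<Rightarrow> bool"
  shows "remdups_adj (map (\<lambda>z. of_bool (P z) :: nat) u) = map of_bool (remdups_adj (map P u))"
proof -
  have "map (\<lambda>z. of_bool (P z) :: nat) u = map of_bool (map P u)" by simp
  moreover have "inj (of_bool :: bool \<Rightarrow> nat)" by (rule injI) (simp only: of_bool_eq_iff)
  ultimately show ?thesis by (simp only: remdups_adj_map_injective)
qed

text \<open>Sending the letters in \<open>P\<close> to the variable 1 and all others to 0 is a
  substitution, so the two-variable image of the identity is satisfied too and Property (C) applies
  to it.\<close>

lemma property_C_projection:
  fixes P :: "var \<Rightarrow> bool"
  assumes "semigroup f" "property_C l f" "satisfies f u v"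
    and "length (remdups_adj (map P u)) \<le> l"
  shows "remdups_adj (map P u) = remdups_adj (map P v)"
proof -
  let ?g = "\<lambda>z. of_bool (P z) :: nat"
  have "subst (\<lambda>z. [?g z]) w = map ?g w" for w
    by (induction w) (simp_all add: subst_def)
  then have sat: "satisfies f (map ?g u) (map ?g v)"
    using satisfies_subst[OF assms(1,3), of "\<lambda>z. [?g z]"] by simp
  have "height (map ?g u) \<le> l"
    using height_le_length_remdups_adj[of "map ?g u"] assms(4)
    by (simp add: remdups_adj_map_of_bool)
  moreover have "map ?g u \<noteq> []" "set (map ?g u) \<subseteq> {0, 1}"
    using assms(3) by (auto simp: satisfies_def)
  ultimately have "same_type (map ?g u) (map ?g v)"
    using assms(2) sat unfolding property_C_def by (metis zero_neq_one)
  then have "remdups_adj (map ?g u) = remdups_adj (map ?g v)"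
    by (rule same_type_imp_remdups_adj_eq)
  moreover have "inj (of_bool :: bool \<Rightarrow> nat)" by (rule injI) (simp only: of_bool_eq_iff)
  ultimately show ?thesis by (simp add: remdups_adj_map_of_bool inj_map_eq_map)
qed

text \<open>If \<open>z\<close> were missing from \<open>v\<close>, its indicator would be constant
  on \<open>v\<close>, giving a single island, but true somewhere on \<open>u\<close>. Property (C)
  is therefore applied to the reversed identity.\<close>

lemma satisfies_content_subset:
  assumes "semigroup f" "property_C l f" "l \<ge> 1" "satisfies f u v"
  shows "set u \<subseteq> set v"
proof (rule ccontr)
  assume "\<not> set u \<subseteq> set v"
  then obtain z where z: "z \<in> set u" "z \<notin> set v" by auto
  have v: "map (\<lambda>t. t = z) v = replicate (length v) False"
    using z(2) by (induction v) auto
  have "length (remdups_adj (map (\<lambda>t. t = z) v)) \<le> l"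
    using assms(3) unfolding v by (simp add: remdups_adj_replicate)
  then have "remdups_adj (map (\<lambda>t. t = z) v) = remdups_adj (map (\<lambda>t. t = z) u)"
    using property_C_projection[OF assms(1,2) satisfies_sym[OF assms(4)]] by blast
  then have "set (map (\<lambda>t. t = z) v) = set (map (\<lambda>t. t = z) u)"
    by (metis remdups_adj_set)
  then show False using z by auto
qed

subsection \<open>Words determined by their two-letter images\<close>

lemma remdups_adj_three_blocks:
  assumes "l \<noteq> []" "m \<noteq> []" "r \<noteq> []" "set l \<subseteq> {a}" "set m \<subseteq> {b}" "set r \<subseteq> {c}"
    and "a \<noteq> b" "b \<noteq> c"
  shows "remdups_adj (l @ m @ r) = [a, b, c]"
proof -
  have const: "\<exists>k. w = replicate (Suc k) d" if "set w \<subseteq> {d}" "w \<noteq> []" for w and d :: 'a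
    using that by (metis Suc_pred length_greater_0_conv replicate_eqI singletonD subsetD)
  obtain i j k where "l = replicate (Suc i) a" "m = replicate (Suc j) b" "r = replicate (Suc k) c"
    using const assms by metis
  moreover have *: "remdups_adj (d # replicate j d @ e # zs) = d # remdups_adj (e # zs)"
    if "d \<noteq> e" for d e :: 'a and j zs
    using that by (induction j) auto
  have "remdups_adj (c # replicate k c) = [c]"
    using remdups_adj_replicate[of "Suc k" c] by simp
  ultimately show ?thesis using assms(7,8) by (simp add: *)
qed

lemma remdups_adj_eq_ConsE:
  assumes "remdups_adj w = a # zs"
  obtains l r where "w = l @ r" "l \<noteq> []" "set l \<subseteq> {a}" "remdups_adj r = zs"
proof -
  have "\<exists>l r. w = l @ r \<and> l \<noteq> [] \<and> set l \<subseteq> {a} \<and> remdups_adj r = zs"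
    using assms
  proof (induction w rule: remdups_adj.induct)
    case (2 b)
    then show ?case by (intro exI[of _ "[b]"] exI[of _ "[]"]) auto
  next
    case (3 b c w)
    show ?case
    proof (cases "b = c")
      case True
      then obtain l r where "b # w = l @ r" "l \<noteq> []" "set l \<subseteq> {a}" "remdups_adj r = zs"
        using 3(1,3) by auto
      moreover have "b = a" using calculation by (cases l) auto
      ultimately show ?thesis using True
        by (intro exI[of _ "a # l"] exI[of _ r]) auto
    next
      case False
      then show ?thesis using 3(3) by (intro exI[of _ "[b]"] exI[of _ "c # w"]) auto
    qed
  qed simp
  then show ?thesis using that by blast
qed

lemma remdups_adj_eq_threeE:
  assumes "remdups_adj w = [a, b, c]"
  obtains l m r where "w = l @ m @ r" "l \<noteq> []" "m \<noteq> []" "r \<noteq> []"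
    "set l \<subseteq> {a}" "set m \<subseteq> {b}" "set r \<subseteq> {c}"
proof -
  obtain l w1 where l: "w = l @ w1" "l \<noteq> []" "set l \<subseteq> {a}" "remdups_adj w1 = [b, c]"
    using remdups_adj_eq_ConsE[OF assms] .
  obtain m w2 where m: "w1 = m @ w2" "m \<noteq> []" "set m \<subseteq> {b}" "remdups_adj w2 = [c]"
    using remdups_adj_eq_ConsE[OF l(4)] .
  obtain r w3 where r: "w2 = r @ w3" "r \<noteq> []" "set r \<subseteq> {c}" "remdups_adj w3 = []"
    using remdups_adj_eq_ConsE[OF m(4)] .
  show ?thesis using that[of l m r] l m r by simp
qed

text \<open>With this pattern the positions whose letters satisfy \<open>P\<close> fill the middle
  block, which is an interval.\<close>

lemma remdups_adj_map_convex:
  assumes "remdups_adj (map P w) = [False, True, False]"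
    and "i < j" "j < k" "k < length w" "P (w ! i)" "P (w ! k)"
  shows "P (w ! j)"
proof -
  obtain l m r where lmr: "map P w = l @ m @ r" "set l \<subseteq> {False}" "set m \<subseteq> {True}" "set r \<subseteq> {False}"
    using remdups_adj_eq_threeE[OF assms(1)] by metis
  have len: "length w = length l + length m + length r"
    using arg_cong[OF lmr(1), of length] by simp
  have nth: "P (w ! n) = (l @ m @ r) ! n" if "n < length w" for n
    using that lmr(1) by (metis nth_map)
  have iff: "P (w ! n) \<longleftrightarrow> length l \<le> n \<and> n < length l + length m" if n: "n < length w" for n
  proof -
    consider "n < length l" | "length l \<le> n" "n < length l + length m"
      | "length l + length m \<le> n" by linarith
    then show ?thesis
    proof cases
      case 1
      then have "l ! n = False" using lmr(2) nth_mem by blast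
      then show ?thesis using 1 nth[OF n] by (simp add: nth_append)
    next
      case 2
      then have "n - length l < length m" by simp
      then have "m ! (n - length l) = True" using lmr(3) nth_mem by blast
      then show ?thesis using 2 nth[OF n] \<open>n - length l < length m\<close> by (simp add: nth_append)
    next
      case 3
      then have "n - length l - length m < length r" using n len by simp
      then have "r ! (n - length l - length m) = False" using lmr(4) nth_mem by blast
      moreover have "\<not> n < length l" "\<not> n - length l < length m" using 3 calculation by auto
      ultimately show ?thesis using 3 nth[OF n] by (simp add: nth_append)
    qed
  qed
  then show ?thesis using assms by auto
qed

text \<open>The outer \<open>z\<close> keep both \<open>False\<close> blocks nonempty even when
  \<open>l\<close> or \<open>r\<close> is empty, so the image has exactly three islands, the bound
  in \<open>property_C 3\<close>.\<close>

lemma remdups_adj_map_factor: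
  assumes "m \<noteq> []" "set m \<inter> set l = {}" "set m \<inter> set r = {}" "z \<notin> set m"
  shows "remdups_adj (map (\<lambda>t. t \<in> set m) (z # (l @ m @ r) @ [z])) = [False, True, False]"
  using remdups_adj_three_blocks[of "map (\<lambda>t. t \<in> set m) (z # l)" "map (\<lambda>t. t \<in> set m) m"
      "map (\<lambda>t. t \<in> set m) (r @ [z])" False True False] assms
  by auto

text \<open>A walk with unit steps that turns around revisits its position of two steps before,
  contrary to injectivity.\<close>

lemma injective_walk_monotone:
  fixes p :: "nat \<Rightarrow> nat"
  assumes "inj_on p {..<n}"
    and "\<And>i. Suc i < n \<Longrightarrow> p (Suc i) = Suc (p i) \<or> p i = Suc (p (Suc i))"
  shows "(\<forall>i. Suc i < n \<longrightarrow> p (Suc i) = Suc (p i)) \<or> (\<forall>i. Suc i < n \<longrightarrow> p i = Suc (p (Suc i)))"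
  using assms
proof (induction n)
  case (Suc n)
  have IH: "(\<forall>i. Suc i < n \<longrightarrow> p (Suc i) = Suc (p i)) \<or> (\<forall>i. Suc i < n \<longrightarrow> p i = Suc (p (Suc i)))"
    using Suc.prems by (intro Suc.IH) (auto elim: inj_on_subset)
  show ?case
  proof (cases "n \<ge> 2")
    case True
    then obtain m where m: "n = Suc (Suc m)" by (metis add_2_eq_Suc le_Suc_ex)
    have ne: "p m \<noteq> p n" using Suc.prems(1) inj_onD[of p "{..<Suc n}" m n] m by fastforce
    have last: "p n = Suc (p (Suc m)) \<or> p (Suc m) = Suc (p n)"
      using Suc.prems(2)[of "Suc m"] m by simp
    have split: "i = Suc m \<or> Suc i < n" if "Suc i < Suc n" for i using that m by linarith
    from IH show ?thesis
    proof
      assume up: "\<forall>i. Suc i < n \<longrightarrow> p (Suc i) = Suc (p i)"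
      then have "p (Suc m) = Suc (p m)" using m by blast
      then have "p n = Suc (p (Suc m))" using ne last by linarith
      then show ?thesis using up split m by blast
    next
      assume down: "\<forall>i. Suc i < n \<longrightarrow> p i = Suc (p (Suc i))"
      then have "p m = Suc (p (Suc m))" using m by blast
      then have "p (Suc m) = Suc (p n)" using ne last by linarith
      then show ?thesis using down split m by blast
    qed
  next
    case False
    then have "i = 0" if "Suc i < Suc n" for i using that by auto
    then show ?thesis using Suc.prems(2)[of 0] by blast
  qed
qed simp

lemma distinct_adj_const: "distinct_adj w \<Longrightarrow> set w \<subseteq> {a} \<Longrightarrow> w \<noteq> [] \<Longrightarrow> w = [a]"
  by (cases w rule: remdups_adj.cases) auto

text \<open>Follow the positions in \<open>zs\<close> of the successive letters of
  \<open>ys\<close>: the adjacency condition makes them an injective walk with unit steps, hence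
  monotone.\<close>

lemma distinct_eq_or_rev_of_adjacent:
  assumes "distinct ys" "distinct zs" "set zs = set ys"
    and adj: "\<And>i. Suc i < length ys \<Longrightarrow>
      \<exists>j. Suc j < length zs \<and> {zs ! j, zs ! Suc j} = {ys ! i, ys ! Suc i}"
  shows "zs = ys \<or> zs = rev ys"
proof -
  define n where "n = length ys"
  have len: "length zs = n" using assms(1-3) unfolding n_def by (metis distinct_card)
  have "\<forall>i\<in>{..<n}. \<exists>j. j < n \<and> zs ! j = ys ! i"
    using assms(3) len unfolding n_def by (metis in_set_conv_nth lessThan_iff)
  then obtain p where p: "\<And>i. i < n \<Longrightarrow> p i < n \<and> zs ! p i = ys ! i"
    by (metis lessThan_iff)
  have "inj_on p {..<n}"
    using p assms(1) unfolding n_def by (metis inj_onI lessThan_iff nth_eq_iff_index_eq)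
  moreover have "p (Suc i) = Suc (p i) \<or> p i = Suc (p (Suc i))" if i: "Suc i < n" for i
  proof -
    obtain j where j: "Suc j < n" "{zs ! j, zs ! Suc j} = {ys ! i, ys ! Suc i}"
      using adj[of i] i len n_def by auto
    have "{zs ! j, zs ! Suc j} = {zs ! p i, zs ! p (Suc i)}" using j(2) p[of i] p[of "Suc i"] i by simp
    then have "(zs ! j = zs ! p i \<and> zs ! Suc j = zs ! p (Suc i)) \<or>
        (zs ! j = zs ! p (Suc i) \<and> zs ! Suc j = zs ! p i)"
      by (auto simp: doubleton_eq_iff)
    then show ?thesis
      using nth_eq_iff_index_eq[OF assms(2)] p[of i] p[of "Suc i"] i j(1) len
      by (metis Suc_lessD)
  qed
  ultimately consider "\<forall>i. Suc i < n \<longrightarrow> p (Suc i) = Suc (p i)"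
    | "\<forall>i. Suc i < n \<longrightarrow> p i = Suc (p (Suc i))"
    using injective_walk_monotone[of p n] by blast
  then show ?thesis
  proof cases
    case 1
    have *: "i < n \<Longrightarrow> p i = p 0 + i" for i using 1 by (induction i) auto
    \<comment> \<open>The bound \<open>p 0 + (n - 1) < n\<close> forces
      \<open>p 0 = 0\<close>.\<close>
    have "p i = i" if "i < n" for i
      using *[of i] *[of "n - 1"] p[of "n - 1"] that by auto
    then have "zs = ys" using p len n_def by (intro nth_equalityI) auto
    then show ?thesis ..
  next
    case 2
    have *: "i < n \<Longrightarrow> p i + i = p 0" for i using 2 by (induction i) auto
    \<comment> \<open>The walk descends \<open>n - 1\<close> steps from \<open>p 0 < n\<close>, so
      \<open>p 0 = n - 1\<close>.\<close>
    have pi: "p i = n - 1 - i" if "i < n" for i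
      using *[of i] *[of "n - 1"] p[of 0] that by auto
    have "zs = rev ys"
    proof (rule nth_equalityI)
      fix i assume "i < length zs"
      then have i: "i < n" using len by simp
      then have "zs ! i = ys ! (n - 1 - i)" using pi[of "n - 1 - i"] p[of "n - 1 - i"] by simp
      then show "zs ! i = rev ys ! i" using i by (simp add: rev_nth n_def)
    qed (simp add: len n_def)
    then show ?thesis ..
  qed
qed

lemma map_eq_append_append:
  "map P w = l @ m @ r \<Longrightarrow>
    \<exists>l' m' r'. w = l' @ m' @ r' \<and> l = map P l' \<and> m = map P m' \<and> r = map P r'"
  by (metis map_eq_append_conv)

text \<open>The predicates tested are the indicators of \<open>x\<close>, of a foreign letter, and
  of factors of \<open>ys\<close> of length one or two. The first fixes the ends, the second
  excludes foreign letters, single letters must occur exactly once, and pairs must stay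
  adjacent.\<close>

lemma eq_or_rev_of_projections:
  fixes x :: 'a
  assumes ys: "distinct ys" "x \<notin> set ys" "ys \<noteq> []"
    and R: "distinct_adj R"
    and proj: "\<And>P :: 'a \<Rightarrow> bool. length (remdups_adj (map P (x # ys @ [x]))) \<le> 3 \<Longrightarrow>
      remdups_adj (map P R) = remdups_adj (map P (x # ys @ [x]))"
  shows "R = x # ys @ [x] \<or> R = x # rev ys @ [x]"
proof -
  have px: "remdups_adj (map (\<lambda>t. t = x) (x # ys @ [x])) = [True, False, True]"
    using remdups_adj_three_blocks[of "map (\<lambda>t. t = x) [x]" "map (\<lambda>t. t = x) ys" "map (\<lambda>t. t = x) [x]"
        True False True] ys by auto
  then have "remdups_adj (map (\<lambda>t. t = x) R) = [True, False, True]"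
    using proj[of "\<lambda>t. t = x"] by simp
  then obtain l m r where lmr: "map (\<lambda>t. t = x) R = l @ m @ r" "l \<noteq> []" "m \<noteq> []" "r \<noteq> []"
    "set l \<subseteq> {True}" "set m \<subseteq> {False}" "set r \<subseteq> {True}"
    by (rule remdups_adj_eq_threeE)
  obtain l' zs r' where R_split: "R = l' @ zs @ r'"
    and l': "l = map (\<lambda>t. t = x) l'" and m: "m = map (\<lambda>t. t = x) zs" and r': "r = map (\<lambda>t. t = x) r'"
    using map_eq_append_append[OF lmr(1)] by auto
  \<comment> \<open>As \<open>R\<close> has no equal neighbours, the outer blocks of
    \<open>x\<close> have length one.\<close>
  have "distinct_adj l'" "distinct_adj r'"
    using R unfolding R_split by (simp_all add: distinct_adj_append_iff)
  moreover have "set l' \<subseteq> {x}" "set r' \<subseteq> {x}" "l' \<noteq> []" "r' \<noteq> []"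
    using lmr(2,4,5,7) unfolding l' r' by auto
  ultimately have "l' = [x]" "r' = [x]"
    by (blast intro: distinct_adj_const)+
  then have Rzs: "R = x # zs @ [x]" using R_split by simp
  have xzs: "x \<notin> set zs" using lmr(6) unfolding m by auto
  have factor: "remdups_adj (map (\<lambda>t. t \<in> set m) R) = [False, True, False]"
    if "ys = l @ m @ r" "m \<noteq> []" for l m r
  proof -
    have "remdups_adj (map (\<lambda>t. t \<in> set m) (x # ys @ [x])) = [False, True, False]"
      unfolding that(1) using ys(1,2) that by (intro remdups_adj_map_factor) auto
    then show ?thesis using proj[of "\<lambda>t. t \<in> set m"] by simp
  qed
  have single: "remdups_adj (map (\<lambda>t. t \<in> {y}) R) = [False, True, False]" if y: "y \<in> set ys" for y
  proof -
    obtain l r where "ys = l @ [y] @ r" using split_list[OF y] by auto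
    then show ?thesis using factor[of l "[y]" r] by simp
  qed
  have set: "set zs = set ys"
  proof (intro subset_antisym subsetI)
    fix z assume z: "z \<in> set zs"
    show "z \<in> set ys"
    proof (rule ccontr)
      assume "z \<notin> set ys"
      then have "map (\<lambda>t. t = z) (x # ys @ [x]) = replicate (length (x # ys @ [x])) False"
        using z xzs by (intro replicate_eqI) auto
      then have "remdups_adj (map (\<lambda>t. t = z) (x # ys @ [x])) = [False]"
        by (simp only: remdups_adj_replicate) simp
      then have "remdups_adj (map (\<lambda>t. t = z) R) = [False]" using proj[of "\<lambda>t. t = z"] by simp
      then have "set (map (\<lambda>t. t = z) R) = {False}"
        by (metis remdups_adj_set empty_set list.simps(15))
      then show False using z Rzs by auto
    qed
  next
    fix z assume z: "z \<in> set ys"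
    have "set (map (\<lambda>t. t \<in> {z}) R) = set [False, True, False]"
      using single[OF z] by (metis remdups_adj_set)
    then have "z \<in> set R" by auto
    then show "z \<in> set zs" using z ys(2) Rzs by auto
  qed
  have nthR: "R ! Suc i = zs ! i" if "i < length zs" for i
    using that by (simp add: Rzs nth_append)
  have adjR: "zs ! i \<noteq> zs ! Suc i" if "Suc i < length zs" for i
    using distinct_adj_nth[OF R, of "Suc i"] that nthR[of i] nthR[of "Suc i"]
    by (simp add: Rzs)
  \<comment> \<open>The letters of a factor of \<open>ys\<close> occupy an interval of
    \<open>zs\<close>; indices in \<open>R\<close> are one higher because of the leading
    \<open>x\<close>.\<close>
  have convex: "zs ! j \<in> set m"
    if "ys = l @ m @ r" "i < j" "j < k" "k < length zs" "zs ! i \<in> set m" "zs ! k \<in> set m" for l m r i j k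
  proof -
    have "m \<noteq> []" using that by auto
    then show ?thesis
      using remdups_adj_map_convex[OF factor[OF that(1)], of "Suc i" "Suc j" "Suc k"] that nthR
      by (simp add: Rzs)
  qed
  have neq: "zs ! i \<noteq> zs ! j" if ij: "i < j" "j < length zs" for i j
  proof
    assume eq: "zs ! i = zs ! j"
    have "Suc i < length zs" using ij by simp
    have "zs ! i \<in> set ys" unfolding set[symmetric] using ij by simp
    then obtain l r where split: "ys = l @ [zs ! i] @ r" using split_list[of "zs ! i" ys] by auto
    \<comment> \<open>Between two occurrences of a letter, convexity for this one-letter factor
      leaves only copies of it, so equal neighbours would arise.\<close>
    have "zs ! Suc i = zs ! i"
    proof (cases "Suc i = j")
      case False
      then have "zs ! Suc i \<in> set [zs ! i]"
        using ij by (intro convex[OF split, of i "Suc i" j]) (simp_all add: eq[symmetric])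
      then show ?thesis by simp
    qed (simp add: eq)
    then show False using adjR[OF \<open>Suc i < length zs\<close>] by simp
  qed
  have dist: "distinct zs"
    using neq unfolding distinct_conv_nth by (metis linorder_neqE_nat)
  have "zs = ys \<or> zs = rev ys"
  proof (rule distinct_eq_or_rev_of_adjacent[OF ys(1) dist set])
    fix i assume i: "Suc i < length ys"
    let ?a = "ys ! i" and ?b = "ys ! Suc i"
    have split: "ys = take i ys @ [?a, ?b] @ drop (Suc (Suc i)) ys"
      using i by (metis Cons_nth_drop_Suc Suc_lessD append_Cons append_Nil append_take_drop_id)
    obtain a b where ab: "a < length zs" "b < length zs" "zs ! a = ?a" "zs ! b = ?b"
      using set i by (metis Suc_lessD in_set_conv_nth)
    have ne: "a \<noteq> b" using ab ys(1) i by (metis Suc_lessD n_not_Suc_n nth_eq_iff_index_eq)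
    have step: "d = Suc c" if cd: "c < d" "d < length zs" "{zs ! c, zs ! d} = {?a, ?b}" for c d
    proof (rule ccontr)
      assume "d \<noteq> Suc c"
      then have lt: "Suc c < d" using cd by simp
      \<comment> \<open>Convexity for the two-letter factor makes any letter between the pair a
        repetition of one of the two.\<close>
      have "zs ! Suc c \<in> set [?a, ?b]"
        using convex[OF split, of c "Suc c" d] lt cd by auto
      then have "zs ! Suc c = zs ! c \<or> zs ! Suc c = zs ! d" using cd(3) by auto
      then show False using neq[of c "Suc c"] neq[of "Suc c" d] lt cd by auto
    qed
    show "\<exists>j. Suc j < length zs \<and> {zs ! j, zs ! Suc j} = {?a, ?b}"
    proof (cases "a < b")
      case True
      then have "b = Suc a" using step[of a b] ab by simp
      then show ?thesis using ab by auto
    next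
      case False
      then have "a = Suc b" using step[of b a] ab ne by (simp add: insert_commute)
      then show ?thesis using ab by auto
    qed
  qed
  then show ?thesis unfolding Rzs by blast
qed

subsection \<open>Deductions from identities in few variables\<close>

lemma successively_const: "successively (=) w \<Longrightarrow> card (set w) \<le> 1"
  by (induction w rule: remdups_adj.induct) auto

text \<open>A change of letter inside \<open>w\<close> would follow an arc of the cycle through
  \<open>x\<close> and \<open>ys\<close> and also an arc of the reversed cycle; with at least three
  letters these cycles share no arc.\<close>

lemma common_arcs_of_reverse:
  assumes ys: "distinct ys" "x \<notin> set ys" "length ys \<ge> 2"
    and U: "remdups_adj (p @ w @ q) = x # ys @ [x]"
    and V: "remdups_adj (p' @ w @ q') = x # rev ys @ [x]"
  shows "card (set w) \<le> 1"
proof -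
  define n where "n = length ys"
  define Y where "Y i = (x # ys) ! i" for i
  have Yinj: "Y i = Y j \<longleftrightarrow> i = j" if "i \<le> n" "j \<le> n" for i j
    using that ys(1,2) nth_eq_iff_index_eq[of "x # ys" i j] unfolding Y_def n_def by simp
  \<comment> \<open>Read cyclically, the first word runs through \<open>Y 0, \<dots>, Y n\<close> along \<open>s\<close>, the second
    one against it; this uses that both ends are \<open>x\<close>.\<close>
  define s where "s i = (if i = n then 0 else Suc i)" for i
  have sle: "s i \<le> n" if "i \<le> n" for i using that unfolding s_def by simp
  \<comment> \<open>Equality is included so that \<open>successively A\<close> is unaffected by
    \<open>remdups_adj\<close>.\<close>
  define A where "A a b \<longleftrightarrow> a = b \<or> (\<exists>i\<le>n. a = Y i \<and> b = Y (s i))" for a b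
  have nthU: "(x # ys @ [x]) ! i = Y (if i = Suc n then 0 else i)" if "i \<le> Suc n" for i
    using that unfolding Y_def n_def by (auto simp: nth_append nth_Cons split: nat.split)
  have sU: "successively A (x # ys @ [x])"
    unfolding successively_conv_nth
  proof (intro allI impI)
    fix i assume "Suc i < length (x # ys @ [x])"
    then have "i \<le> n" by (simp add: n_def)
    then show "A ((x # ys @ [x]) ! i) ((x # ys @ [x]) ! Suc i)"
      using nthU[of i] nthU[of "Suc i"] unfolding A_def s_def by (intro disjI2 exI[of _ i]) auto
  qed
  then have sV: "successively (\<lambda>a b. A b a) (x # rev ys @ [x])"
    using successively_rev[of "\<lambda>a b. A b a" "x # ys @ [x]"] by simp
  have refl: "A a a" for a unfolding A_def by simp
  have "successively A (p @ w @ q)"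
    using sU successively_remdups_adj_iff[of "p @ w @ q" A] refl unfolding U by blast
  moreover have "successively (\<lambda>a b. A b a) (p' @ w @ q')"
    using sV successively_remdups_adj_iff[of "p' @ w @ q'" "\<lambda>a b. A b a"] refl unfolding V by blast
  ultimately have w: "successively A w" "successively (\<lambda>a b. A b a) w"
    unfolding successively_append_iff by blast+
  have eq: "a = b" if "A a b" "A b a" for a b
  proof (rule ccontr)
    assume "a \<noteq> b"
    obtain i where i: "i \<le> n" "a = Y i" "b = Y (s i)"
      using \<open>A a b\<close> \<open>a \<noteq> b\<close> unfolding A_def by blast
    obtain j where j: "j \<le> n" "b = Y j" "a = Y (s j)"
      using \<open>A b a\<close> \<open>a \<noteq> b\<close> unfolding A_def by blast
    have "s i = j" using Yinj[OF sle[OF i(1)] j(1)] i(3) j(2) by simp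
    moreover have "s j = i" using Yinj[OF sle[OF j(1)] i(1)] i(2) j(3) by simp
    \<comment> \<open>So \<open>s (s i) = i\<close>, impossible on a cycle of length
      \<open>n + 1\<close>, which is at least three.\<close>
    ultimately show False using ys(3) unfolding s_def n_def by (auto split: if_splits)
  qed
  have "successively (=) w"
    unfolding successively_conv_nth
  proof (intro allI impI)
    fix i assume "Suc i < length w"
    then show "w ! i = w ! Suc i"
      using successively_nth[OF w(1)] successively_nth[OF w(2)] by (intro eq)
  qed
  then show ?thesis by (rule successively_const)
qed

lemma set_subst: "set (subst \<theta> u) = (\<Union>t\<in>set u. set (\<theta> t))"
  by (simp add: subst_def)

lemma subst_factor: "t \<in> set u \<Longrightarrow> \<exists>l r. subst \<theta> u = l @ \<theta> t @ r"
  by (fastforce simp: in_set_conv_decomp subst_def)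

lemma few_variables_step:
  assumes f: "semigroup f" "property_C 3 f" and uv: "satisfies f u v"
    and ys: "distinct ys" "x \<notin> set ys" "length ys \<ge> 2" "card (set u) + 1 < length ys"
    and \<theta>: "\<And>t. \<theta> t \<noteq> []"
    and U: "remdups_adj (p @ subst \<theta> u @ q) = x # ys @ [x]"
  shows "remdups_adj (p @ subst \<theta> v @ q) = x # ys @ [x]"
proof -
  let ?U = "p @ subst \<theta> u @ q" and ?V = "p @ subst \<theta> v @ q"
  have sat: "satisfies f ?U ?V"
    using f(1) uv \<theta> by (intro satisfies_context satisfies_subst)
  have "remdups_adj ?V = x # ys @ [x] \<or> remdups_adj ?V = x # rev ys @ [x]"
  proof (rule eq_or_rev_of_projections[OF ys(1,2)])
    show "ys \<noteq> []" using ys(3) by auto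
    fix P :: "var \<Rightarrow> bool" assume "length (remdups_adj (map P (x # ys @ [x]))) \<le> 3"
    then show "remdups_adj (map P (remdups_adj ?V)) = remdups_adj (map P (x # ys @ [x]))"
      using property_C_projection[OF f sat, of P] U
      by (metis remdups_adj_map_remdups_adj)
  qed simp
  moreover have False if V: "remdups_adj ?V = x # rev ys @ [x]"
  proof -
    \<comment> \<open>The words share \<open>p\<close> as a prefix and \<open>q\<close> as a suffix,
      so these are common factors with an empty context on one side.\<close>
    have p: "card (set p) \<le> 1"
      using common_arcs_of_reverse[OF ys(1-3), of "[]" p _ "[]"] U V by simp
    have q: "card (set q) \<le> 1"
      using common_arcs_of_reverse[OF ys(1-3), of "p @ subst \<theta> u" q "[]" "p @ subst \<theta> v" "[]"] U V by simp
    have t: "card (set (\<theta> t)) \<le> 1" if "t \<in> set u" for t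
    proof -
      \<comment> \<open>The variable also occurs in \<open>v\<close>, so its image is a factor of
        both words.\<close>
      have "t \<in> set v" using satisfies_content_subset[OF f _ uv] that by auto
      then obtain l r l' r' where "subst \<theta> u = l @ \<theta> t @ r" "subst \<theta> v = l' @ \<theta> t @ r'"
        using subst_factor \<open>t \<in> set u\<close> by metis
      then show ?thesis
        using common_arcs_of_reverse[OF ys(1-3), of "p @ l" "\<theta> t" "r @ q" "p @ l'" "r' @ q"] U V by simp
    qed
    have "card (set (subst \<theta> u)) \<le> (\<Sum>t\<in>set u. card (set (\<theta> t)))"
      unfolding set_subst by (rule card_UN_le) simp
    also have "\<dots> \<le> card (set u)"
      using sum_mono[of "set u" "\<lambda>t. card (set (\<theta> t))" "\<lambda>_. 1"] t by simp
    \<comment> \<open>Here \<open>p\<close> and \<open>q\<close> add at most one letter each,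
      whereas the word has \<open>length ys + 1\<close> distinct letters, more than
      \<open>card (set u) + 2\<close>.\<close>
    finally have "card (set ?U) \<le> card (set u) + 2"
      using p q card_Un_le[of "set p" "set (subst \<theta> u) \<union> set q"] card_Un_le[of "set (subst \<theta> u)" "set q"]
      by simp
    moreover have "set ?U = set (x # ys @ [x])" using U by (metis remdups_adj_set)
    then have "card (set ?U) = Suc (length ys)" using ys(1,2) by (simp add: distinct_card)
    ultimately show False using ys(4) by simp
  qed
  ultimately show ?thesis by blast
qed

text \<open>Contexts and substitutions are quantified so that \<open>mult\<close> and
  \<open>subst\<close> pass through the induction: the former enlarges the context, the latter
  composes substitutions. The equivalence takes care of \<open>sym\<close>.\<close>

lemma deducible_invariant:
  assumes step: "\<And>u v \<theta> p q. (u, v) \<in> \<Sigma> \<Longrightarrow> (\<And>t. \<theta> t \<noteq> []) \<Longrightarrow>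
      Q (p @ subst \<theta> u @ q) \<longleftrightarrow> Q (p @ subst \<theta> v @ q)"
    and "deducible \<Sigma> u v"
    and "\<And>t. \<theta> t \<noteq> []"
  shows "Q (p @ subst \<theta> u @ q) \<longleftrightarrow> Q (p @ subst \<theta> v @ q)"
  using assms(2,3)
proof (induction arbitrary: \<theta> p q rule: deducible.induct)
  case (mult u v u' v')
  have app: "subst \<theta> (a @ b) = subst \<theta> a @ subst \<theta> b" for a b by (simp add: subst_def)
  show ?case
    using mult.IH(1)[of \<theta> p "subst \<theta> u' @ q"] mult.IH(2)[of \<theta> "p @ subst \<theta> v" q] mult.prems
    unfolding app append_assoc by blast
next
  case (subst u v \<sigma>)
  have comp: "Defs.subst \<theta> (Defs.subst \<sigma> w) = Defs.subst (\<lambda>t. Defs.subst \<theta> (\<sigma> t)) w" for w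
    by (induction w) (auto simp: subst_def)
  show ?case
    using subst.IH[of "\<lambda>t. Defs.subst \<theta> (\<sigma> t)" p q] subst.hyps subst.prems subst_ne
    unfolding comp by blast
next
  case (axm u v)
  then show ?case using step by blast
qed blast+

theorem mainTheorem4:
  fixes f :: "'a \<Rightarrow> 'a \<Rightarrow> 'a" and k :: nat and x :: var and y :: "nat \<Rightarrow> var"
  assumes "semigroup f"
    and "property_C 3 f"
    and "k \<ge> 2"
    and "inj_on y {1..}" and "x \<notin> y ` {1..}"
    and "\<And>n. n \<ge> 2 \<Longrightarrow>
      satisfies f
        (replicate k x @ concat (map (\<lambda>i. replicate k (y i)) [1..<Suc n]) @ replicate k x)
        (replicate k x @ concat (map (\<lambda>i. replicate k (y i)) (rev [1..<Suc n])) @ replicate k x)"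
  shows "\<not> finitely_based f"
proof
  assume "finitely_based f"
  then obtain \<Sigma> where \<Sigma>: "finite \<Sigma>" "\<And>u v. (u, v) \<in> \<Sigma> \<Longrightarrow> satisfies f u v"
    "\<And>u v. satisfies f u v \<Longrightarrow> deducible \<Sigma> u v"
    unfolding finitely_based_def by blast
  define vars where "vars = (\<Union>(u, v)\<in>\<Sigma>. set u \<union> set v)"
  \<comment> \<open>Chosen so that each side of an identity in \<open>\<Sigma>\<close> meets the
    bound \<open>card (set u) + 1 < length ys\<close> of \<open>few_variables_step\<close>, and so
    that \<open>n \<ge> 2\<close>.\<close>
  define n where "n = card vars + 2"
  define ys where "ys = map y [1..<Suc n]"
  have finv: "finite vars" using \<Sigma>(1) unfolding vars_def by auto
  have len: "length ys = n" by (simp add: ys_def del: upt_Suc)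
  have dist: "distinct ys"
    using assms(4) unfolding ys_def by (auto simp: distinct_map simp del: upt_Suc elim: inj_on_subset)
  have xys: "x \<notin> set ys" using assms(5) unfolding ys_def by (auto simp del: upt_Suc)
  let ?Q = "\<lambda>w. remdups_adj w = x # ys @ [x]"
  let ?W = "\<lambda>zs. concat (map (replicate k) (x # zs @ [x]))"
  have "?Q (p @ subst \<theta> u @ q) \<longleftrightarrow> ?Q (p @ subst \<theta> v @ q)"
    if uv: "(u, v) \<in> \<Sigma>" and \<theta>: "\<And>t. \<theta> t \<noteq> []" for u v \<theta> p q
  proof -
    have "set u \<subseteq> vars" "set v \<subseteq> vars" using uv unfolding vars_def by auto
    then have "card (set u) + 1 < length ys" "card (set v) + 1 < length ys"
      using card_mono[OF finv, of "set u"] card_mono[OF finv, of "set v"] unfolding len n_def by simp_all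
    moreover have "length ys \<ge> 2" unfolding len n_def by simp
    ultimately show ?thesis
      using few_variables_step[OF assms(1,2) \<Sigma>(2)[OF uv] dist xys, of \<theta> p q]
        few_variables_step[OF assms(1,2) satisfies_sym[OF \<Sigma>(2)[OF uv]] dist xys, of \<theta> p q] \<theta>
      by blast
  qed
  moreover have "deducible \<Sigma> (?W ys) (?W (rev ys))"
    using \<Sigma>(3)[OF assms(6)[of n]]
    by (simp add: ys_def n_def comp_def rev_map del: upt_Suc)
  \<comment> \<open>The empty context and the identity substitution turn the invariant into a
    statement on the given identity itself.\<close>
  ultimately have "?Q ([] @ subst (\<lambda>t. [t]) (?W ys) @ []) \<longleftrightarrow> ?Q ([] @ subst (\<lambda>t. [t]) (?W (rev ys)) @ [])"
    by (rule deducible_invariant) simp_all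
  moreover have "subst (\<lambda>t. [t]) w = w" for w by (induction w) (auto simp: subst_def)
  ultimately have iff: "?Q (?W ys) \<longleftrightarrow> ?Q (?W (rev ys))" by (simp only: append_Nil append_Nil2)
  have k: "k \<ge> 1" using assms(3) by simp
  have adj: "remdups_adj (x # zs @ [x]) = x # zs @ [x]" if "distinct zs" "x \<notin> set zs" "zs \<noteq> []" for zs
  proof -
    have "distinct_adj zs" using that(1) by (simp add: distinct_adj_altdef remdups_adj_distinct)
    moreover have "hd (zs @ [x]) \<noteq> x" "last zs \<noteq> x"
      using that(2,3) hd_in_set[of zs] last_in_set[of zs] by auto
    ultimately have "distinct_adj (x # zs @ [x])"
      by (auto simp: distinct_adj_append_iff distinct_adj_Cons)
    then show ?thesis by (simp only: distinct_adj_altdef)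
  qed
  have "ys \<noteq> []" using len n_def by auto
  \<comment> \<open>Both sides of the given identity would have the same type, making
    \<open>ys\<close> a palindrome; but its first and last letters differ since
    \<open>n \<ge> 2\<close>.\<close>
  then have "rev ys = ys"
    using iff adj[of ys] adj[of "rev ys"] dist xys
    unfolding remdups_adj_concat_replicate[OF k] by simp
  then have "ys ! 0 = ys ! (n - 1)"
    using len n_def rev_nth[of 0 ys] by simp
  then show False using dist len n_def by (simp add: nth_eq_iff_index_eq)
qed

end
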